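(* Let $X$, $Y$ and $Z$ be finite $T_0$-spaces and let $g\colon X\to Y$ and $f\colon Y\to Z$ be continuous maps. Then $\mathcal{U}(fg) \leq \mathcal{U}(f)\mathcal{U}(g)$ and $\mathcal{F}(fg) \geq \mathcal{F}(f)\mathcal{F}(g)$. If, in addition, $\mathcal{U}(X)\cap\mathcal{F}(X)=\varnothing$ and $\mathcal{U}(Y)\cap\mathcal{F}(Y)=\varnothing$, then $\mathcal{C}(fg) \simeq \mathcal{C}(f)\mathcal{C}(g)$.
   Context: A finite $T_0$-space is identified with a finite poset: $x\le y$ iff $U_x\subseteq U_y$, where $U_x=\{z\mid z\le x\}$ is the minimal open set containing $x$; $F_x=\{z\mid z\ge x\}$ is the smallest closed set containing $x$. Open sets are the down-sets, and continuous maps are the order-preserving maps. Maps into a poset are compared pointwise, $fg$ denotes the composition $f\circ g$, and $\simeq$ denotes homotopy of continuous maps. $\mathrm{mxl}(X)$ and $\mathrm{mnl}(X)$ are the sets of maximal and minimal elements of $X$. For a non-empty subset $A\subseteq X$ let $U_A=\bigcap_{a\in A}U_a$ and $F_A=\bigcap_{a\in A}F_a$. $\mathcal{U}(X)$ is the set of all connected components of the non-empty sets $U_A$ with $\varnothing\ne A\subseteq \mathrm{mxl}(X)$; $\mathcal{F}(X)$ is the set of all connected components of the non-empty sets $F_A$ with $\varnothing\neq A\subseteq\mathrm{mnl}(X)$. $\mathcal{U}(X)$ is the poset (finite $T_0$-space) ordered by $\subseteq$, and $\mathcal{F}(X)$ is the poset ordered by $\supseteq$ (that is, $C_1\le C_2$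 iff $C_1\supseteq C_2$). $\mathcal{C}(X)$ is the poset with underlying set $\mathcal{U}(X)\cup\mathcal{F}(X)$ where $C_1\le C_2$ iff one of the following holds: $C_1,C_2\in\mathcal{U}(X)$ and $C_1\subseteq C_2$; $C_1,C_2\in\mathcal{F}(X)$ and $C_1\supseteq C_2$; $C_1\in\mathcal{F}(X)$, $C_2\in\mathcal{U}(X)$ and $C_1\cap C_2\ne\varnothing$. For a continuous map $f\colon X\to Y$: $\mathcal{U}(f)\colon\mathcal{U}(X)\to\mathcal{U}(Y)$, $\mathcal{U}(f)(C)=\min\{D\in\mathcal{U}(Y)\mid f(C)\subseteq D\}$ (minimum in the poset $\mathcal{U}(Y)$), and $\mathcal{F}(f)\colon\mathcal{F}(X)\to\mathcal{F}(Y)$, $\mathcal{F}(f)(C)=\max\{D\in\mathcal{F}(Y)\mid f(C)\subseteq D\}$ (maximum in the poset $\mathcal{F}(Y)$, i.e. the smallest such $D$ for inclusion); these exist and define continuous maps. If $\mathcal{U}(X)\cap\mathcal{F}(X)=\varnothing$, $\mathcal{C}(f)\colon\mathcal{C}(X)\to\mathcal{C}(Y)$ is the (continuous) map equal to $\mathcal{U}(f)$ on $\mathcal{U}(X)$ and to $\mathcal{F}(f)$ on $\mathcal{F}(X)$. *)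

theory Defs
  imports "HOL-Analysis.Analysis"
begin

section \<open>Finite \<open>T\<^sub>0\<close>-spaces and their posets\<close>

definition finite_T0_space :: "'a topology \<Rightarrow> bool" where
  "finite_T0_space X \<longleftrightarrow> finite (topspace X) \<and> t0_space X"

definition min_open :: "'a topology \<Rightarrow> 'a \<Rightarrow> 'a set" where
  "min_open X x = \<Inter>{U. openin X U \<and> x \<in> U}"

definition point_le :: "'a topology \<Rightarrow> 'a \<Rightarrow> 'a \<Rightarrow> bool" where
  "point_le X x y \<longleftrightarrow> x \<in> topspace X \<and> y \<in> topspace X \<and> min_open X x \<subseteq> min_open X y"

definition min_closed :: "'a topology \<Rightarrow> 'a \<Rightarrow> 'a set" where
  "min_closed X x = {z. point_le X x z}"

definition mxl :: "'a topology \<Rightarrow> 'a set" where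
  "mxl X = {x \<in> topspace X. \<forall>y. point_le X x y \<longrightarrow> y = x}"

definition mnl :: "'a topology \<Rightarrow> 'a set" where
  "mnl X = {x \<in> topspace X. \<forall>y. point_le X y x \<longrightarrow> y = x}"

text \<open>The topology of a poset with carrier \<open>P\<close> and order \<open>le\<close>: the open sets are the down-sets.\<close>

definition poset_topology :: "'a set \<Rightarrow> ('a \<Rightarrow> 'a \<Rightarrow> bool) \<Rightarrow> 'a topology" where
  "poset_topology P le = topology (\<lambda>S. S \<subseteq> P \<and> (\<forall>x\<in>S. \<forall>y\<in>P. le y x \<longrightarrow> y \<in> S))"

lemma openin_poset_topology:
  "openin (poset_topology P le) S \<longleftrightarrow> S \<subseteq> P \<and> (\<forall>x\<in>S. \<forall>y\<in>P. le y x \<longrightarrow> y \<in> S)"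
proof -
  have "istopology (\<lambda>S. S \<subseteq> P \<and> (\<forall>x\<in>S. \<forall>y\<in>P. le y x \<longrightarrow> y \<in> S))"
    unfolding istopology_def by blast
  then show ?thesis
    by (simp add: poset_topology_def topology_inverse')
qed

lemma topspace_poset_topology: "topspace (poset_topology P le) = P"
  unfolding topspace_def openin_poset_topology by blast

definition pointwise_le :: "'a set \<Rightarrow> ('b \<Rightarrow> 'b \<Rightarrow> bool) \<Rightarrow> ('a \<Rightarrow> 'b) \<Rightarrow> ('a \<Rightarrow> 'b) \<Rightarrow> bool" where
  "pointwise_le P le h k \<longleftrightarrow> (\<forall>x\<in>P. le (h x) (k x))"


section \<open>The posets \<open>\<U>(X)\<close>, \<open>\<F>(X)\<close> and \<open>\<C>(X)\<close>\<close>

definition U_set :: "'a topology \<Rightarrow> 'a set \<Rightarrow> 'a set" where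
  "U_set X A = (\<Inter>a\<in>A. min_open X a)"

definition F_set :: "'a topology \<Rightarrow> 'a set \<Rightarrow> 'a set" where
  "F_set X A = (\<Inter>a\<in>A. min_closed X a)"

definition U_cal :: "'a topology \<Rightarrow> 'a set set" where
  "U_cal X = \<Union>{connected_components_of (subtopology X (U_set X A)) | A.
                 A \<noteq> {} \<and> A \<subseteq> mxl X \<and> U_set X A \<noteq> {}}"

definition F_cal :: "'a topology \<Rightarrow> 'a set set" where
  "F_cal X = \<Union>{connected_components_of (subtopology X (F_set X A)) | A.
                 A \<noteq> {} \<and> A \<subseteq> mnl X \<and> F_set X A \<noteq> {}}"

text \<open>The orders below hold only between elements of the respective carrier.  Note that
  \<open>\<F>(X)\<close> is ordered by reverse inclusion.\<close>

definition U_le :: "'a topology \<Rightarrow> 'a set \<Rightarrow> 'a set \<Rightarrow> bool" where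
  "U_le X C1 C2 \<longleftrightarrow> C1 \<in> U_cal X \<and> C2 \<in> U_cal X \<and> C1 \<subseteq> C2"

definition F_le :: "'a topology \<Rightarrow> 'a set \<Rightarrow> 'a set \<Rightarrow> bool" where
  "F_le X C1 C2 \<longleftrightarrow> C1 \<in> F_cal X \<and> C2 \<in> F_cal X \<and> C1 \<supseteq> C2"

definition C_cal :: "'a topology \<Rightarrow> 'a set set" where
  "C_cal X = U_cal X \<union> F_cal X"

definition C_le :: "'a topology \<Rightarrow> 'a set \<Rightarrow> 'a set \<Rightarrow> bool" where
  "C_le X C1 C2 \<longleftrightarrow> U_le X C1 C2 \<or> F_le X C1 C2 \<or>
     (C1 \<in> F_cal X \<and> C2 \<in> U_cal X \<and> C1 \<inter> C2 \<noteq> {})"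

definition C_space :: "'a topology \<Rightarrow> 'a set topology" where
  "C_space X = poset_topology (C_cal X) (C_le X)"


section \<open>The induced maps\<close>

text \<open>For a continuous map \<open>f: X \<rightarrow> Y\<close> of finite \<open>T\<^sub>0\<close>-spaces the minimum and the maximum
  described here exist for every \<open>C\<close> in \<open>\<U>(X)\<close>, respectively in \<open>\<F>(X)\<close>; the values at other
  arguments are irrelevant.\<close>

definition U_map :: "'b topology \<Rightarrow> ('a \<Rightarrow> 'b) \<Rightarrow> 'a set \<Rightarrow> 'b set" where
  "U_map Y f C = (THE D. D \<in> U_cal Y \<and> f ` C \<subseteq> D \<and>
                     (\<forall>D'\<in>U_cal Y. f ` C \<subseteq> D' \<longrightarrow> U_le Y D D'))"

definition F_map :: "'b topology \<Rightarrow> ('a \<Rightarrow> 'b) \<Rightarrow> 'a set \<Rightarrow> 'b set" where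
  "F_map Y f C = (THE D. D \<in> F_cal Y \<and> f ` C \<subseteq> D \<and>
                     (\<forall>D'\<in>F_cal Y. f ` C \<subseteq> D' \<longrightarrow> F_le Y D' D))"

text \<open>Only meaningful if \<open>\<U>(X)\<close> and \<open>\<F>(X)\<close> are disjoint.\<close>

definition C_map :: "'a topology \<Rightarrow> 'b topology \<Rightarrow> ('a \<Rightarrow> 'b) \<Rightarrow> 'a set \<Rightarrow> 'b set" where
  "C_map X Y f C = (if C \<in> U_cal X then U_map Y f C else F_map Y f C)"

end

theory Submission
  imports Defs
begin

text \<open>
  Both \<open>\<U>(Y)\<close> and \<open>\<F>(Y)\<close> consist of the connected components of the intersections of a family of
  subsets of \<open>Y\<close> (the sets \<open>U\<^sub>b\<close> with \<open>b\<close> maximal, or the sets \<open>F\<^sub>b\<close> with \<open>b\<close> minimal).  For such a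
  collection of components, every non-empty connected set \<open>S\<close> that lies in one set of the family has
  a smallest member around it: intersect all sets of the family that contain \<open>S\<close> and take the
  component of \<open>S\<close>.  This is \<open>least_component_ex\<close>, and with \<open>S = f(C)\<close> it says that \<open>\<U>(f)(C)\<close> and
  \<open>\<F>(f)(C)\<close> are, for inclusion, the least members that contain \<open>f(C)\<close>.  Since \<open>\<U>(f)(\<U>(g)(C))\<close> contains
  \<open>f(g(C))\<close>, it contains \<open>\<U>(fg)(C)\<close>; the same holds for \<open>\<F>\<close>, where reversing inclusion reverses the
  inequality.

  The two inequalities point in opposite directions, so \<open>\<C>(fg)\<close> and \<open>\<C>(f)\<C>(g)\<close> need not be
  comparable.  Both lie, however, below the map that is \<open>\<U>(f)\<U>(g)\<close> on \<open>\<U>(X)\<close> and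
  \<open>\<F>(fg)\<close> on \<open>\<F>(X)\<close>, the pointwise larger choice on each part.  This map is order preserving: the
  only relation between the two parts is \<open>C\<^sub>1 \<le> C\<^sub>2\<close> for \<open>C\<^sub>1\<close> in \<open>\<F>(X)\<close> and \<open>C\<^sub>2\<close> in \<open>\<U>(X)\<close> that meet,
  and the images still meet because each of them contains \<open>f(g(C\<^sub>1 \<inter> C\<^sub>2))\<close>
  (\<open>glued_map_continuous\<close>).  Comparable continuous maps into a poset are homotopic
  (\<open>homotopic_pointwise_le\<close>), and two such homotopies give the result.
\<close>

section \<open>Minimal open sets and extremal points\<close>

lemma min_open_subset_topspace: "x \<in> topspace X \<Longrightarrow> min_open X x \<subseteq> topspace X"
  unfolding min_open_def by blast

lemma point_le_iff_mem_min_open: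
  "x \<in> topspace X \<Longrightarrow> y \<in> topspace X \<Longrightarrow> point_le X x y \<longleftrightarrow> x \<in> min_open X y"
  unfolding point_le_def min_open_def by blast

lemma min_openI: "point_le X x y \<Longrightarrow> x \<in> min_open X y"
  unfolding point_le_def min_open_def by blast

lemma point_le_refl: "x \<in> topspace X \<Longrightarrow> point_le X x x"
  unfolding point_le_def by blast

lemma point_le_trans: "point_le X x y \<Longrightarrow> point_le X y z \<Longrightarrow> point_le X x z"
  unfolding point_le_def by blast

lemma point_le_antisym:
  assumes "t0_space X" "point_le X x y" "point_le X y x"
  shows "x = y"
proof (rule ccontr)
  assume "x \<noteq> y"
  moreover have "x \<in> topspace X" "y \<in> topspace X"
    using assms unfolding point_le_def by auto
  ultimately obtain V where "openin X V" "x \<notin> V \<longleftrightarrow> y \<in> V"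
    using assms(1) unfolding t0_space_def by blast
  moreover have "x \<in> min_open X y" "y \<in> min_open X x"
    using assms(2,3) by (auto intro: min_openI)
  ultimately show False
    unfolding min_open_def by blast
qed

lemma continuous_map_point_le:
  assumes "continuous_map X Y f" "point_le X x y"
  shows "point_le Y (f x) (f y)"
proof -
  have xy: "x \<in> topspace X" "y \<in> topspace X"
    using assms(2) unfolding point_le_def by auto
  then have fxy: "f x \<in> topspace Y" "f y \<in> topspace Y"
    using continuous_map_image_subset_topspace[OF assms(1)] by auto
  have "f x \<in> V" if "openin Y V" "f y \<in> V" for V
  proof -
    have "openin X {x \<in> topspace X. f x \<in> V}"
      using assms(1) that(1) by (rule openin_continuous_map_preimage)
    moreover have "x \<in> min_open X y"
      using assms(2) by (rule min_openI)
    ultimately show ?thesis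
      using that(2) xy unfolding min_open_def by blast
  qed
  then show ?thesis
    using fxy by (simp add: point_le_iff_mem_min_open) (simp add: min_open_def)
qed

text \<open>By finiteness some \<open>m\<close> above \<open>x\<close> has an inclusion-maximal minimal open set; a point above \<open>m\<close> then
  has the same minimal open set, and the \<open>T\<^sub>0\<close> property identifies the two points.\<close>

lemma mxl_above:
  assumes "finite_T0_space X" "x \<in> topspace X"
  obtains m where "m \<in> mxl X" "point_le X x m"
proof -
  let ?S = "{y. point_le X x y}"
  have t0: "t0_space X"
    using assms(1) unfolding finite_T0_space_def by blast
  have "finite ?S"
    by (rule finite_subset[of _ "topspace X"])
      (use assms(1) in \<open>auto simp: finite_T0_space_def point_le_def\<close>)
  moreover have "?S \<noteq> {}"
    using point_le_refl[OF assms(2)] by auto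
  ultimately obtain m where m: "point_le X x m"
    and max: "\<And>y. point_le X x y \<Longrightarrow> min_open X m \<subseteq> min_open X y \<Longrightarrow> min_open X m = min_open X y"
    using finite_has_maximal[of "min_open X ` ?S"] by auto
  have "y = m" if "point_le X m y" for y
  proof -
    have "min_open X m = min_open X y"
      using max[OF point_le_trans[OF m that]] that unfolding point_le_def by blast
    then have "point_le X y m"
      using that unfolding point_le_def by blast
    with t0 show ?thesis
      using that by (rule point_le_antisym)
  qed
  then have "m \<in> mxl X"
    using m unfolding mxl_def point_le_def by blast
  then show ?thesis
    using that m by blast
qed

lemma mnl_below:
  assumes "finite_T0_space X" "x \<in> topspace X"
  obtains m where "m \<in> mnl X" "point_le X m x"
proof -
  let ?S = "{y. point_le X y x}"
  have t0: "t0_space X"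
    using assms(1) unfolding finite_T0_space_def by blast
  have "finite ?S"
    by (rule finite_subset[of _ "topspace X"])
      (use assms(1) in \<open>auto simp: finite_T0_space_def point_le_def\<close>)
  moreover have "?S \<noteq> {}"
    using point_le_refl[OF assms(2)] by auto
  ultimately obtain m where m: "point_le X m x"
    and min: "\<And>y. point_le X y x \<Longrightarrow> min_open X y \<subseteq> min_open X m \<Longrightarrow> min_open X m = min_open X y"
    using finite_has_minimal[of "min_open X ` ?S"] by auto
  have "y = m" if "point_le X y m" for y
  proof -
    have "min_open X m = min_open X y"
      using min[OF point_le_trans[OF that m]] that unfolding point_le_def by blast
    then have "point_le X m y"
      using that unfolding point_le_def by blast
    with t0 that show ?thesis
      by (rule point_le_antisym)
  qed
  then have "m \<in> mnl X"
    using m unfolding mnl_def point_le_def by blast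
  then show ?thesis
    using that m by blast
qed


section \<open>Components of intersections of a family of sets\<close>

text \<open>The common form of \<open>\<U>(X)\<close> and \<open>\<F>(X)\<close>.  Members are compared by plain inclusion rather than by
  the orders of these posets, so that one argument serves for both.\<close>

definition component_family :: "'a topology \<Rightarrow> ('i \<Rightarrow> 'a set) \<Rightarrow> 'i set \<Rightarrow> 'a set set" where
  "component_family X V M = \<Union>{connected_components_of (subtopology X (\<Inter>a\<in>A. V a)) | A.
     A \<noteq> {} \<and> A \<subseteq> M \<and> (\<Inter>a\<in>A. V a) \<noteq> {}}"

lemma U_cal_eq_component_family: "U_cal X = component_family X (min_open X) (mxl X)"
  unfolding U_cal_def component_family_def U_set_def ..

lemma F_cal_eq_component_family: "F_cal X = component_family X (min_closed X) (mnl X)"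
  unfolding F_cal_def component_family_def F_set_def ..

lemma component_familyE:
  assumes "C \<in> component_family X V M"
  obtains A where "A \<noteq> {}" "A \<subseteq> M" "C \<in> connected_components_of (subtopology X (\<Inter>a\<in>A. V a))"
  using assms unfolding component_family_def by blast

lemma component_family_connectedin:
  assumes "C \<in> component_family X V M"
  shows "connectedin X C" "C \<noteq> {}"
proof -
  obtain A where "C \<in> connected_components_of (subtopology X (\<Inter>a\<in>A. V a))"
    using assms by (rule component_familyE)
  then show "connectedin X C" "C \<noteq> {}"
    using connectedin_connected_components_of connectedin_subtopology
      nonempty_connected_components_of by blast+
qed

lemma component_family_subset:
  assumes "C \<in> component_family X V M"
  obtains a where "a \<in> M" "C \<subseteq> V a"
proof -
  obtain A where A: "A \<noteq> {}" "A \<subseteq> M" "C \<in> connected_components_of (subtopology X (\<Inter>a\<in>A. V a))"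
    using assms by (rule component_familyE)
  have "C \<subseteq> (\<Inter>a\<in>A. V a)"
    using connected_components_of_subset[OF A(3)] by (simp add: topspace_subtopology)
  then show ?thesis
    using that A(1,2) by blast
qed

text \<open>The more sets of the family are intersected, the smaller the components; so the component to take
  is that of \<open>S\<close> in the intersection of all the sets \<open>V a\<close> that contain \<open>S\<close>.\<close>

lemma least_component_ex:
  assumes S: "connectedin X S" "S \<noteq> {}" and a: "a \<in> M" "S \<subseteq> V a"
  shows "\<exists>D\<in>component_family X V M. S \<subseteq> D \<and> (\<forall>D'\<in>component_family X V M. S \<subseteq> D' \<longrightarrow> D \<subseteq> D')"
proof -
  define A where "A = {a \<in> M. S \<subseteq> V a}"
  let ?I = "\<lambda>A. subtopology X (\<Inter>a\<in>A. V a)"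
  have SA: "S \<subseteq> (\<Inter>a\<in>A. V a)"
    unfolding A_def by blast
  have A: "A \<noteq> {}" "A \<subseteq> M" "(\<Inter>a\<in>A. V a) \<noteq> {}"
    using a S(2) SA unfolding A_def by blast+
  have "connectedin (?I A) S"
    using S(1) SA by (simp add: connectedin_subtopology)
  moreover from this S(2) have "?I A \<noteq> trivial_topology"
    using connectedin_subset_topspace by force
  ultimately obtain D where D: "D \<in> connected_components_of (?I A)" "S \<subseteq> D"
    using exists_connected_component_of_superset by metis
  have "D \<subseteq> D'" if D': "D' \<in> component_family X V M" "S \<subseteq> D'" for D'
  proof -
    obtain A' where A': "A' \<subseteq> M" "D' \<in> connected_components_of (?I A')"
      using D'(1) by (rule component_familyE)
    have "D' \<subseteq> (\<Inter>a\<in>A'. V a)"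
      using connected_components_of_subset[OF A'(2)] by (simp add: topspace_subtopology)
    then have "A' \<subseteq> A"
      using D'(2) A'(1) unfolding A_def by blast
    moreover have "connectedin X D" "D \<subseteq> (\<Inter>a\<in>A. V a)"
      using connectedin_connected_components_of[OF D(1)] by (simp_all add: connectedin_subtopology)
    ultimately have "connectedin (?I A') D"
      by (auto simp: connectedin_subtopology)
    moreover have "\<not> disjnt D' D"
      using D(2) D'(2) S(2) unfolding disjnt_def by blast
    ultimately show ?thesis
      using connected_components_of_maximal[OF A'(2)] by blast
  qed
  moreover have "D \<in> component_family X V M"
    using D(1) A unfolding component_family_def by blast
  ultimately show ?thesis
    using D(2) by blast
qed


section \<open>The maps induced on \<open>\<U>\<close> and \<open>\<F>\<close>\<close>

text \<open>A set \<open>C\<close> in \<open>\<U>(X)\<close> lies below one maximal point \<open>a\<close>, so \<open>f(C)\<close> lies below \<open>f(a)\<close> and hence below any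
  maximal point \<open>b\<close> above \<open>f(a)\<close>.  Thus \<open>f(C)\<close>, which is connected, has a least member of \<open>\<U>(Y)\<close> around it.\<close>

lemma U_map_least:
  assumes "finite_T0_space Y" "continuous_map X Y f" "C \<in> U_cal X"
  shows U_map_in: "U_map Y f C \<in> U_cal Y"
    and image_subset_U_map: "f ` C \<subseteq> U_map Y f C"
    and U_map_subset: "\<And>D. D \<in> U_cal Y \<Longrightarrow> f ` C \<subseteq> D \<Longrightarrow> U_map Y f C \<subseteq> D"
proof -
  have C: "C \<in> component_family X (min_open X) (mxl X)"
    using assms(3) unfolding U_cal_eq_component_family .
  obtain a where a: "a \<in> mxl X" "C \<subseteq> min_open X a"
    using C by (rule component_family_subset)
  have aX: "a \<in> topspace X"
    using a(1) unfolding mxl_def by blast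
  then have "f a \<in> topspace Y"
    using continuous_map_image_subset_topspace[OF assms(2)] by blast
  then obtain b where b: "b \<in> mxl Y" "point_le Y (f a) b"
    using mxl_above assms(1) by metis
  have conn: "connectedin Y (f ` C)" "f ` C \<noteq> {}"
    using component_family_connectedin[OF C] connectedin_continuous_map_image[OF assms(2)] by simp_all
  have "f c \<in> min_open Y b" if "c \<in> C" for c
  proof -
    have "point_le X c a"
      using that a(2) aX min_open_subset_topspace[OF aX] point_le_iff_mem_min_open[of c X a]
      by (meson subsetD)
    then have "point_le Y (f c) b"
      by (rule point_le_trans[OF continuous_map_point_le[OF assms(2)] b(2)])
    then show ?thesis
      by (rule min_openI)
  qed
  then have "f ` C \<subseteq> min_open Y b"
    by blast
  then have "\<exists>D\<in>U_cal Y. f ` C \<subseteq> D \<and> (\<forall>D'\<in>U_cal Y. f ` C \<subseteq> D' \<longrightarrow> D \<subseteq> D')"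
    unfolding U_cal_eq_component_family by (rule least_component_ex[OF conn b(1)])
  then obtain D where D: "D \<in> U_cal Y" "f ` C \<subseteq> D"
    and least: "\<And>D'. D' \<in> U_cal Y \<Longrightarrow> f ` C \<subseteq> D' \<Longrightarrow> D \<subseteq> D'"
    by (elim bexE conjE) simp
  have "U_map Y f C = D"
    unfolding U_map_def
  proof (rule the_equality)
    show "D \<in> U_cal Y \<and> f ` C \<subseteq> D \<and> (\<forall>D'\<in>U_cal Y. f ` C \<subseteq> D' \<longrightarrow> U_le Y D D')"
      using D least by (simp add: U_le_def)
  next
    fix E
    assume E: "E \<in> U_cal Y \<and> f ` C \<subseteq> E \<and> (\<forall>D'\<in>U_cal Y. f ` C \<subseteq> D' \<longrightarrow> U_le Y E D')"
    then have "E \<subseteq> D"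
      using D unfolding U_le_def by simp
    moreover have "D \<subseteq> E"
      using E least by simp
    ultimately show "E = D"
      by (rule equalityI)
  qed
  then show "U_map Y f C \<in> U_cal Y" "f ` C \<subseteq> U_map Y f C"
    "\<And>D'. D' \<in> U_cal Y \<Longrightarrow> f ` C \<subseteq> D' \<Longrightarrow> U_map Y f C \<subseteq> D'"
    using D least by simp_all
qed

text \<open>The dual argument, with minimal points.  The maximum in the definition of \<open>\<F>(f)\<close> is taken
  in the reversed order, so for inclusion it is again a least member.\<close>

lemma F_map_least:
  assumes "finite_T0_space Y" "continuous_map X Y f" "C \<in> F_cal X"
  shows F_map_in: "F_map Y f C \<in> F_cal Y"
    and image_subset_F_map: "f ` C \<subseteq> F_map Y f C"
    and F_map_subset: "\<And>D. D \<in> F_cal Y \<Longrightarrow> f ` C \<subseteq> D \<Longrightarrow> F_map Y f C \<subseteq> D"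
proof -
  have C: "C \<in> component_family X (min_closed X) (mnl X)"
    using assms(3) unfolding F_cal_eq_component_family .
  obtain a where a: "a \<in> mnl X" "C \<subseteq> min_closed X a"
    using C by (rule component_family_subset)
  have "f a \<in> topspace Y"
    using a(1) continuous_map_image_subset_topspace[OF assms(2)] unfolding mnl_def by blast
  then obtain b where b: "b \<in> mnl Y" "point_le Y b (f a)"
    using mnl_below assms(1) by metis
  have conn: "connectedin Y (f ` C)" "f ` C \<noteq> {}"
    using component_family_connectedin[OF C] connectedin_continuous_map_image[OF assms(2)] by simp_all
  have "f c \<in> min_closed Y b" if "c \<in> C" for c
    using that a(2) point_le_trans[OF b(2) continuous_map_point_le[OF assms(2)]]
    unfolding min_closed_def by blast
  then have "f ` C \<subseteq> min_closed Y b"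
    by blast
  then have "\<exists>D\<in>F_cal Y. f ` C \<subseteq> D \<and> (\<forall>D'\<in>F_cal Y. f ` C \<subseteq> D' \<longrightarrow> D \<subseteq> D')"
    unfolding F_cal_eq_component_family by (rule least_component_ex[OF conn b(1)])
  then obtain D where D: "D \<in> F_cal Y" "f ` C \<subseteq> D"
    and least: "\<And>D'. D' \<in> F_cal Y \<Longrightarrow> f ` C \<subseteq> D' \<Longrightarrow> D \<subseteq> D'"
    by (elim bexE conjE) simp
  have "F_map Y f C = D"
    unfolding F_map_def
  proof (rule the_equality)
    show "D \<in> F_cal Y \<and> f ` C \<subseteq> D \<and> (\<forall>D'\<in>F_cal Y. f ` C \<subseteq> D' \<longrightarrow> F_le Y D' D)"
      using D least by (simp add: F_le_def)
  next
    fix E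
    assume E: "E \<in> F_cal Y \<and> f ` C \<subseteq> E \<and> (\<forall>D'\<in>F_cal Y. f ` C \<subseteq> D' \<longrightarrow> F_le Y D' E)"
    then have "E \<subseteq> D"
      using D unfolding F_le_def by simp
    moreover have "D \<subseteq> E"
      using E least by simp
    ultimately show "E = D"
      by (rule equalityI)
  qed
  then show "F_map Y f C \<in> F_cal Y" "f ` C \<subseteq> F_map Y f C"
    "\<And>D'. D' \<in> F_cal Y \<Longrightarrow> f ` C \<subseteq> D' \<Longrightarrow> F_map Y f C \<subseteq> D'"
    using D least by simp_all
qed

text \<open>These properties, unlike minimality, are inherited by composites: \<open>\<U>(f)\<U>(g)\<close> need not be least
  over \<open>fg\<close>, but it still covers \<open>fg\<close> monotonically.  They are also all that is needed to glue a map
  on \<open>\<U>(X)\<close> to one on \<open>\<F>(X)\<close>.\<close>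

definition monotone_cover :: "('a \<Rightarrow> 'b) \<Rightarrow> 'a set set \<Rightarrow> 'b set set \<Rightarrow> ('a set \<Rightarrow> 'b set) \<Rightarrow> bool" where
  "monotone_cover h \<A> \<B> u \<longleftrightarrow> (\<forall>C\<in>\<A>. u C \<in> \<B> \<and> h ` C \<subseteq> u C) \<and>
     (\<forall>C\<in>\<A>. \<forall>C'\<in>\<A>. C \<subseteq> C' \<longrightarrow> u C \<subseteq> u C')"

lemma monotone_coverD:
  assumes "monotone_cover h \<A> \<B> u" "C \<in> \<A>"
  shows "u C \<in> \<B>" "h ` C \<subseteq> u C" "C' \<in> \<A> \<Longrightarrow> C \<subseteq> C' \<Longrightarrow> u C \<subseteq> u C'"
  using assms unfolding monotone_cover_def by simp_all

lemma monotone_cover_U_map: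
  assumes "finite_T0_space Y" "continuous_map X Y f"
  shows "monotone_cover f (U_cal X) (U_cal Y) (U_map Y f)"
proof -
  have "U_map Y f C \<subseteq> U_map Y f C'" if "C \<in> U_cal X" "C' \<in> U_cal X" "C \<subseteq> C'" for C C'
    using that U_map_in[OF assms that(2)] image_subset_U_map[OF assms that(2)]
    by (intro U_map_subset[OF assms that(1)]) auto
  then show ?thesis
    using U_map_in[OF assms] image_subset_U_map[OF assms] unfolding monotone_cover_def by blast
qed

lemma monotone_cover_F_map:
  assumes "finite_T0_space Y" "continuous_map X Y f"
  shows "monotone_cover f (F_cal X) (F_cal Y) (F_map Y f)"
proof -
  have "F_map Y f C \<subseteq> F_map Y f C'" if "C \<in> F_cal X" "C' \<in> F_cal X" "C \<subseteq> C'" for C C'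
    using that F_map_in[OF assms that(2)] image_subset_F_map[OF assms that(2)]
    by (intro F_map_subset[OF assms that(1)]) auto
  then show ?thesis
    using F_map_in[OF assms] image_subset_F_map[OF assms] unfolding monotone_cover_def by blast
qed

lemma monotone_cover_comp:
  assumes u: "monotone_cover g \<A> \<B> u" and v: "monotone_cover f \<B> \<D> v"
  shows "monotone_cover (f \<circ> g) \<A> \<D> (v \<circ> u)"
proof -
  have "(f \<circ> g) ` C \<subseteq> v (u C)" if "C \<in> \<A>" for C
  proof -
    have "f ` g ` C \<subseteq> f ` u C"
      using monotone_coverD(2)[OF u that] by (rule image_mono)
    also have "\<dots> \<subseteq> v (u C)"
      using v monotone_coverD(1)[OF u that] by (rule monotone_coverD)
    finally show ?thesis
      by (simp add: image_comp)
  qed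
  then show ?thesis
    unfolding monotone_cover_def using monotone_coverD[OF u] monotone_coverD[OF v] by simp
qed


section \<open>Order, continuity and homotopy\<close>

lemma continuous_map_poset_topology:
  assumes "\<And>x. x \<in> P \<Longrightarrow> h x \<in> Q"
    and "\<And>x y. x \<in> P \<Longrightarrow> y \<in> P \<Longrightarrow> le x y \<Longrightarrow> le' (h x) (h y)"
  shows "continuous_map (poset_topology P le) (poset_topology Q le') h"
  unfolding continuous_map topspace_poset_topology openin_poset_topology
  using assms by blast

text \<open>The homotopy stays at the lower map for \<open>t < 1\<close> and jumps at \<open>t = 1\<close>.  It is continuous because an
  open set is a down-set: where it contains the value of the upper map, it contains that of the lower
  one as well, so the preimage of
  \<open>D\<close> is \<open>[0,1] \<times> k\<^sup>-\<^sup>1(D) \<union> [0,1) \<times> h\<^sup>-\<^sup>1(D)\<close>.\<close>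

lemma homotopic_pointwise_le:
  assumes h: "continuous_map X (poset_topology Q le) h"
    and k: "continuous_map X (poset_topology Q le) k"
    and le: "pointwise_le (topspace X) le h k"
  shows "homotopic_with (\<lambda>_. True) X (poset_topology Q le) h k"
proof -
  let ?I = "top_of_set {0..1::real}"
  let ?H = "\<lambda>(t::real, x). if t = 1 then k x else h x"
  have hk: "h x \<in> Q" "k x \<in> Q" if "x \<in> topspace X" for x
    using that continuous_map_image_subset_topspace[OF h] continuous_map_image_subset_topspace[OF k]
    by (auto simp: topspace_poset_topology)
  have "openin (prod_topology ?I X) {p \<in> topspace (prod_topology ?I X). ?H p \<in> D}"
    if D: "openin (poset_topology Q le) D" for D
  proof -
    have eq: "{p \<in> topspace (prod_topology ?I X). ?H p \<in> D} =
        {0..1} \<times> {x \<in> topspace X. k x \<in> D} \<union> {0..<1} \<times> {x \<in> topspace X. h x \<in> D}"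
      using D le hk unfolding openin_poset_topology pointwise_le_def
      by (auto split: if_splits)
    have "openin ?I {0..<1}"
    proof -
      have "{0..<1} = {0..1} \<inter> {..<1::real}"
        by auto
      then show ?thesis
        by (metis open_lessThan openin_open)
    qed
    moreover have "openin ?I {0..1}"
      by simp
    ultimately show ?thesis
      unfolding eq using openin_continuous_map_preimage[OF h D] openin_continuous_map_preimage[OF k D]
      by (intro openin_Un) (auto simp: openin_prod_Times_iff)
  qed
  then have "continuous_map (prod_topology ?I X) (poset_topology Q le) ?H"
    using hk unfolding continuous_map by (auto simp: topspace_poset_topology)
  then show ?thesis
    unfolding homotopic_with_def by (intro exI[of _ ?H]) auto
qed

text \<open>If \<open>C\<^sub>1\<close> in \<open>\<F>(X)\<close> meets \<open>C\<^sub>2\<close> in \<open>\<U>(X)\<close>, then \<open>v C\<^sub>1\<close> meets \<open>u C\<^sub>2\<close> because both contain \<open>h(C\<^sub>1 \<inter> C\<^sub>2)\<close>.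
  Hence \<open>u\<close> and \<open>v\<close> can be chosen independently of each other.\<close>

lemma glued_map_continuous:
  assumes disj: "U_cal X \<inter> F_cal X = {}"
    and u: "monotone_cover h (U_cal X) (U_cal Z) u"
    and v: "monotone_cover h (F_cal X) (F_cal Z) v"
  shows "continuous_map (C_space X) (C_space Z) (\<lambda>C. if C \<in> U_cal X then u C else v C)"
  unfolding C_space_def
proof (rule continuous_map_poset_topology)
  show "(if C \<in> U_cal X then u C else v C) \<in> C_cal Z" if "C \<in> C_cal X" for C
    using that u v unfolding C_cal_def monotone_cover_def by auto
next
  fix C C'
  assume "C_le X C C'"
  then consider (U) "U_le X C C'" | (F) "F_le X C C'"
    | (FU) "C \<in> F_cal X" "C' \<in> U_cal X" "C \<inter> C' \<noteq> {}"
    unfolding C_le_def by blast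
  then show "C_le Z (if C \<in> U_cal X then u C else v C) (if C' \<in> U_cal X then u C' else v C')"
  proof cases
    case U
    then have "U_le Z (u C) (u C')"
      using monotone_coverD[OF u] unfolding U_le_def by simp
    then show ?thesis
      using U unfolding C_le_def U_le_def by auto
  next
    case F
    then have "F_le Z (v C) (v C')"
      using monotone_coverD[OF v] unfolding F_le_def by simp
    moreover have "C \<notin> U_cal X" "C' \<notin> U_cal X"
      using F disj unfolding F_le_def by blast+
    ultimately show ?thesis
      unfolding C_le_def by auto
  next
    case FU
    then have "v C \<in> F_cal Z" "u C' \<in> U_cal Z" "h ` C \<subseteq> v C" "h ` C' \<subseteq> u C'"
      using monotone_coverD[OF u] monotone_coverD[OF v] by simp_all
    moreover from this(3,4) have "v C \<inter> u C' \<noteq> {}"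
      using FU(3) by blast
    moreover have "C \<notin> U_cal X"
      using FU(1) disj by blast
    ultimately show ?thesis
      using FU(2) unfolding C_le_def by auto
  qed
qed


section \<open>Composition\<close>

theorem proposition3p22:
  fixes X :: "'a topology" and Y :: "'b topology" and Z :: "'c topology"
    and g :: "'a \<Rightarrow> 'b" and f :: "'b \<Rightarrow> 'c"
  assumes "finite_T0_space X" and "finite_T0_space Y" and "finite_T0_space Z"
    and "continuous_map X Y g" and "continuous_map Y Z f"
  shows "pointwise_le (U_cal X) (U_le Z) (U_map Z (f \<circ> g)) (U_map Z f \<circ> U_map Y g) \<and>
    pointwise_le (F_cal X) (F_le Z) (F_map Z f \<circ> F_map Y g) (F_map Z (f \<circ> g)) \<and>
    (U_cal X \<inter> F_cal X = {} \<and> U_cal Y \<inter> F_cal Y = {} \<longrightarrow>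
      homotopic_with (\<lambda>_. True) (C_space X) (C_space Z)
        (C_map X Z (f \<circ> g)) (C_map Y Z f \<circ> C_map X Y g))"
proof (intro conjI impI)
  have fg: "continuous_map X Z (f \<circ> g)"
    using assms(4,5) by (rule continuous_map_compose)
  note U_fg = monotone_cover_U_map[OF assms(3) fg]
  note F_fg = monotone_cover_F_map[OF assms(3) fg]
  have U_f_U_g: "monotone_cover (f \<circ> g) (U_cal X) (U_cal Z) (U_map Z f \<circ> U_map Y g)"
    using monotone_cover_U_map[OF assms(2,4)] monotone_cover_U_map[OF assms(3,5)]
    by (rule monotone_cover_comp)
  have F_f_F_g: "monotone_cover (f \<circ> g) (F_cal X) (F_cal Z) (F_map Z f \<circ> F_map Y g)"
    using monotone_cover_F_map[OF assms(2,4)] monotone_cover_F_map[OF assms(3,5)]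
    by (rule monotone_cover_comp)
  show U: "pointwise_le (U_cal X) (U_le Z) (U_map Z (f \<circ> g)) (U_map Z f \<circ> U_map Y g)"
    using monotone_coverD[OF U_fg] monotone_coverD[OF U_f_U_g] U_map_subset[OF assms(3) fg]
    unfolding pointwise_le_def U_le_def by simp
  show F: "pointwise_le (F_cal X) (F_le Z) (F_map Z f \<circ> F_map Y g) (F_map Z (f \<circ> g))"
    using monotone_coverD[OF F_fg] monotone_coverD[OF F_f_F_g] F_map_subset[OF assms(3) fg]
    unfolding pointwise_le_def F_le_def by simp

  assume "U_cal X \<inter> F_cal X = {} \<and> U_cal Y \<inter> F_cal Y = {}"
  then have disjX: "U_cal X \<inter> F_cal X = {}" and disjY: "U_cal Y \<inter> F_cal Y = {}"
    by auto
  let ?glue = "\<lambda>u v C. if C \<in> U_cal X then u C else v C"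
  let ?h = "?glue (U_map Z (f \<circ> g)) (F_map Z (f \<circ> g))"
  let ?k = "?glue (U_map Z f \<circ> U_map Y g) (F_map Z f \<circ> F_map Y g)"
  let ?m = "?glue (U_map Z f \<circ> U_map Y g) (F_map Z (f \<circ> g))"
  have top: "topspace (C_space X) = U_cal X \<union> F_cal X"
    unfolding C_space_def topspace_poset_topology C_cal_def ..
  note cont = glued_map_continuous[OF disjX]
  have U_refl: "U_le Z (U_map Z f (U_map Y g C)) (U_map Z f (U_map Y g C))" if "C \<in> U_cal X" for C
    using monotone_coverD(1)[OF U_f_U_g that] unfolding U_le_def by simp
  have F_refl: "F_le Z (F_map Z (f \<circ> g) C) (F_map Z (f \<circ> g) C)" if "C \<in> F_cal X" for C
    using monotone_coverD(1)[OF F_fg that] unfolding F_le_def by simp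
  have "pointwise_le (topspace (C_space X)) (C_le Z) ?h ?m"
    using U F_refl unfolding pointwise_le_def top C_le_def by auto
  then have hm: "homotopic_with (\<lambda>_. True) (C_space X) (C_space Z) ?h ?m"
    using cont[OF U_fg F_fg] cont[OF U_f_U_g F_fg] homotopic_pointwise_le
    unfolding C_space_def by blast
  have "pointwise_le (topspace (C_space X)) (C_le Z) ?k ?m"
    using F U_refl unfolding pointwise_le_def top C_le_def by auto
  then have km: "homotopic_with (\<lambda>_. True) (C_space X) (C_space Z) ?k ?m"
    using cont[OF U_f_U_g F_f_F_g] cont[OF U_f_U_g F_fg] homotopic_pointwise_le
    unfolding C_space_def by blast
  have hk: "homotopic_with (\<lambda>_. True) (C_space X) (C_space Z) ?h ?k"
    using hm km homotopic_with_symD homotopic_with_trans by blast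
  \<comment> \<open>Disjointness in \<open>Y\<close> ensures that \<open>\<C>(f)\<close> applies \<open>\<F>(f)\<close>, and not \<open>\<U>(f)\<close>, to \<open>\<F>(g)(C)\<close>.\<close>
  have comp: "(C_map Y Z f \<circ> C_map X Y g) C = ?k C" if "C \<in> topspace (C_space X)" for C
  proof (cases "C \<in> U_cal X")
    case True
    then show ?thesis
      using U_map_in[OF assms(2,4)] by (simp add: C_map_def)
  next
    case False
    then have "F_map Y g C \<in> F_cal Y"
      using F_map_in[OF assms(2,4)] that top by blast
    then have "F_map Y g C \<notin> U_cal Y"
      using disjY by blast
    then show ?thesis
      using False by (simp add: C_map_def)
  qed
  show "homotopic_with (\<lambda>_. True) (C_space X) (C_space Z)
      (C_map X Z (f \<circ> g)) (C_map Y Z f \<circ> C_map X Y g)"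
    by (rule homotopic_with_eq[OF hk]) (use comp in \<open>auto simp: C_map_def\<close>)
qed

end
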